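(* Let $\omega$ be the filter constructed from $\kappa$, $\theta$ and $\delta$ by $$\omega(h,b)(v):=\begin{cases}\delta\big(\theta(h.b,b)^{-1}h,b\big)\,\kappa(h.b,b)(h.v)&(h.b,b)\in R,\\0&(h.b,b)\notin R,\end{cases}$$ for $h\in G$, $b\in B$, $v\in E_b$. Let $f\in\Gamma(E)$ be a continuous section and let $\tilde f\colon G\times B\to E$, $(h,b)\mapsto h^{-1}.f(h.b)$ be the corresponding Mackey section. Then $$(\omega\star\tilde f)(e,b)=T_\kappa(f)(b)$$ for any $b\in B$.
   Context: $G$ is a Hausdorff topological group with neutral element $e$, and $B$ is a Hausdorff topological space with a continuous left action $(g,b)\mapsto g.b$; $G_b$ is the stabilizer and $G.b\subseteq B$ the orbit of $b$ (subspace topologies). A $G$-equivariant real vector bundle $E\to B$ is a (finite-rank, locally trivial) real vector bundle with a continuous left $G$-action on $E$ such that the projection is $G$-equivariant and each $g\in G$ maps the fiber $E_b$ linearly to $E_{g.b}$. Let $E\to B$ and $F\to B$ be $G$-equivariant real vector bundles; $\Gamma(E)$ denotes continuous sections. Measures: We have three families of locally finite Borel measures $\{\mu_b\colon\mathcal B(G)\to[0,\infty]\}_{b\in B}$, $\{\bar\mu_b\colon\mathcal B(G.b)\to[0,\infty]\}_{b\in B}$, and $\{\nu_b\colon\mathcal B(G_b)\to[0,\infty]\}_{b\in B}$, each $\nu_b$ left-invariant, such that for all $g\in G$, $b\in B$: $\mu_{g.b}=c_{g*}\mu_b$, $\nu_{g.b}=c_{g*}\nu_b$ (pushforwards along the conjugations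 $c_g\colon G\to G$ resp. $c_g\colon G_b\to G_{g.b}$, $h\mapsto ghg^{-1}$), and $\bar\mu_{g.b}=(g.\_)_*\bar\mu_b$ (pushforward along $c\mapsto g.c$). The family $\{\mu_b\}$ is continuous: $b\mapsto\int_G f'\,d\mu_b$ is continuous for every compactly supported continuous $f'\colon G\to\mathbb R$. Moreover, for all $b\in B$ and compactly supported continuous $f'\colon G\to\mathbb R$, $$\int_G f'(h)\,d\mu_b(h)=\int_{G.b}\int_{G_b}f'(kh)\,d\nu_b(h)\,d\bar\mu_b(k.b),$$ where for a point $c\in G.b$ of the outer integration $k$ is any element of $G$ with $k.b=c$ (the inner integral does not depend on the choice, by left-invariance of $\nu_b$). Function $\delta$: $\delta\colon\{(h,b)\in G\times B\mid h\in G_b\}\to[0,\infty)$ is continuous, each $\delta(-,b)\colon G_b\to[0,\infty)$ is compactly supported with $\int_{G_b}\delta(h,b)\,d\nu_b(h)=1$, and $\delta(ghg^{-1},g.b)=\delta(h,b)$ for all $g\in G$, $b\in B$, $h\in G_b$. Kernel: Let $\bigsqcup_{b\in B}G.b:=\{(c,b)\in B\times B\mid c\in G.b\}$ with the subspace topology of $B\times B$. View $E\times B$ and $B\times F$ as vector bundles over $B\times B$, so $\mathrm{Hom}(E\times B,B\times F)$ has fiber $\mathrm{Hom}(E_c,F_b)$ over $(c,b)$. The kernel $\kappa\colon\bigsqcup_{b\in B}G.b\to\mathrm{Hom}(E\times B,B\times F)$ is continuous with $\kappa(c,b)\in\mathrm{Hom}(E_c,F_b)$, each $\kappa(-,b)$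 on $G.b$ is compactly supported, and $g.\kappa(c,b)(v)=\kappa(g.c,g.b)(g.v)$ for all $g\in G$, $b\in B$, $c\in G.b$, $v\in E_c$. The orbitwise integral transform is $T_\kappa(f)(b):=\int_{G.b}\kappa(c,b)(f(c))\,d\bar\mu_b(c)$. Choice of $R$ and $\theta$: $R\subseteq\bigsqcup_{b\in B}G.b$ is a closed subset containing the support of $\kappa$ and invariant under the diagonal $G$-action, and $\theta\colon R\to G$ is a continuous map with $c=\theta(c,b).b$ and $g\theta(c,b)=\theta(g.c,g.b)g$ for all $g\in G$, $(c,b)\in R$. Cross-correlation: $(\omega\star\tilde f)(h,b):=\int_G\omega(k,b)(\tilde f(hk,b))\,d\mu_b(k)$. *)

theory Defs
  imports "HOL-Analysis.Analysis"
begin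

text \<open>
  A topological group is a type of class \<open>topological_group_add\<close>: the library writes
  (not necessarily commutative) topological groups additively, so \<open>g + h\<close> is the product
  \<open>gh\<close>, \<open>0\<close> the neutral element \<open>e\<close>, \<open>- g\<close> the inverse, and
  \<open>g + h - g\<close> the conjugate \<open>g h g\<^sup>-\<^sup>1\<close>.
\<close>

section \<open>Actions\<close>

definition continuous_action ::
  "('g::topological_group_add \<Rightarrow> 'x::topological_space \<Rightarrow> 'x) \<Rightarrow> bool"
  where "continuous_action act \<longleftrightarrow>
    (\<forall>x. act 0 x = x) \<and>
    (\<forall>g h x. act (g + h) x = act g (act h x)) \<and>
    continuous_on UNIV (\<lambda>(g, x). act g x)"

definition stabilizer :: "('g \<Rightarrow> 'b \<Rightarrow> 'b) \<Rightarrow> 'b \<Rightarrow> 'g set"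
  where "stabilizer act b = {g. act g b = b}"

definition orbit :: "('g \<Rightarrow> 'b \<Rightarrow> 'b) \<Rightarrow> 'b \<Rightarrow> 'b set"
  where "orbit act b = range (\<lambda>g. act g b)"

definition orbit_pairs :: "('g \<Rightarrow> 'b \<Rightarrow> 'b) \<Rightarrow> ('b \<times> 'b) set"
  where "orbit_pairs act = {(c, b). c \<in> orbit act b}"

section \<open>Supports and Borel measures on subspaces\<close>

text \<open>The support, relative to the subspace \<open>S\<close>, of a function on \<open>S\<close> whose
  set of non-zeros is \<open>N \<subseteq> S\<close>.\<close>

definition support_in :: "'a::topological_space set \<Rightarrow> 'a set \<Rightarrow> 'a set"
  where "support_in S N = S \<inter> closure N"

definition compactly_supported_on :: "'a::topological_space set \<Rightarrow> ('a \<Rightarrow> real) \<Rightarrow> bool"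
  where "compactly_supported_on S f \<longleftrightarrow> compact (support_in S {x \<in> S. f x \<noteq> 0})"

text \<open>The Borel \<open>\<sigma>\<close>-algebra of a subspace is the trace of the ambient one.\<close>

definition locally_finite_borel_measure_on ::
  "'a::topological_space set \<Rightarrow> 'a measure \<Rightarrow> bool"
  where "locally_finite_borel_measure_on S M \<longleftrightarrow>
    sets M = sets (restrict_space borel S) \<and>
    (\<forall>x\<in>S. \<exists>U. open U \<and> x \<in> U \<and> emeasure M (U \<inter> S) < \<infinity>)"

section \<open>Vector bundles\<close>

text \<open>The base and the total space are the types \<open>'b\<close> and \<open>'e\<close>.  The operations
  \<open>vadd\<close>, \<open>vscale\<close> are meaningful only within a single fiber; \<open>vzero\<close> is the zero section.\<close>

record ('b, 'e) vbundle =
  proj :: "'e \<Rightarrow> 'b"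
  vadd :: "'e \<Rightarrow> 'e \<Rightarrow> 'e"
  vscale :: "real \<Rightarrow> 'e \<Rightarrow> 'e"
  vzero :: "'b \<Rightarrow> 'e"

definition fiber :: "('b, 'e) vbundle \<Rightarrow> 'b \<Rightarrow> 'e set"
  where "fiber E b = {x. proj E x = b}"

definition vector_space_fiber :: "('b, 'e) vbundle \<Rightarrow> 'b \<Rightarrow> bool"
  where "vector_space_fiber E b \<longleftrightarrow>
    vzero E b \<in> fiber E b \<and>
    (\<forall>x\<in>fiber E b. \<forall>y\<in>fiber E b. vadd E x y \<in> fiber E b) \<and>
    (\<forall>a. \<forall>x\<in>fiber E b. vscale E a x \<in> fiber E b) \<and>
    (\<forall>x\<in>fiber E b. \<forall>y\<in>fiber E b. \<forall>z\<in>fiber E b.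
      vadd E (vadd E x y) z = vadd E x (vadd E y z)) \<and>
    (\<forall>x\<in>fiber E b. \<forall>y\<in>fiber E b. vadd E x y = vadd E y x) \<and>
    (\<forall>x\<in>fiber E b. vadd E x (vzero E b) = x) \<and>
    (\<forall>x\<in>fiber E b. \<exists>y\<in>fiber E b. vadd E x y = vzero E b) \<and>
    (\<forall>a. \<forall>x\<in>fiber E b. \<forall>y\<in>fiber E b.
      vscale E a (vadd E x y) = vadd E (vscale E a x) (vscale E a y)) \<and>
    (\<forall>a a'. \<forall>x\<in>fiber E b. vscale E (a + a') x = vadd E (vscale E a x) (vscale E a' x)) \<and>
    (\<forall>a a'. \<forall>x\<in>fiber E b. vscale E (a * a') x = vscale E a (vscale E a' x)) \<and>
    (\<forall>x\<in>fiber E b. vscale E 1 x = x)"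

text \<open>Linear maps from the fiber of \<open>E\<close> over \<open>c\<close> to the fiber of \<open>F\<close> over \<open>b\<close>.\<close>

definition fiber_linear ::
  "('b, 'e) vbundle \<Rightarrow> ('d, 'f) vbundle \<Rightarrow> 'b \<Rightarrow> 'd \<Rightarrow> ('e \<Rightarrow> 'f) \<Rightarrow> bool"
  where "fiber_linear E F c b L \<longleftrightarrow>
    (\<forall>x\<in>fiber E c. L x \<in> fiber F b) \<and>
    (\<forall>x\<in>fiber E c. \<forall>y\<in>fiber E c. L (vadd E x y) = vadd F (L x) (L y)) \<and>
    (\<forall>a. \<forall>x\<in>fiber E c. L (vscale E a x) = vscale F a (L x))"

definition fiber_functional :: "('b, 'e) vbundle \<Rightarrow> 'b \<Rightarrow> ('e \<Rightarrow> real) \<Rightarrow> bool"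
  where "fiber_functional E b l \<longleftrightarrow>
    (\<forall>x\<in>fiber E b. \<forall>y\<in>fiber E b. l (vadd E x y) = l x + l y) \<and>
    (\<forall>a. \<forall>x\<in>fiber E b. l (vscale E a x) = a * l x)"

text \<open>\<open>\<phi>\<close> is the vector component of a local trivialization over \<open>U\<close>.  The model fiber
  \<open>Euclidean_space n\<close> consists of the \<open>v :: nat \<Rightarrow> real\<close> with \<open>v i = 0\<close> for \<open>i \<ge> n\<close>, so that
  the rank can be chosen locally.\<close>

definition trivialization ::
  "('b::topological_space, 'e::topological_space) vbundle \<Rightarrow> 'b set \<Rightarrow> nat \<Rightarrow>
    ('e \<Rightarrow> nat \<Rightarrow> real) \<Rightarrow> bool"
  where "trivialization E U n \<phi> \<longleftrightarrow>
    open U \<and>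
    homeomorphic_map (top_of_set (proj E -` U))
      (prod_topology (top_of_set U) (Euclidean_space n)) (\<lambda>x. (proj E x, \<phi> x)) \<and>
    (\<forall>b\<in>U. \<forall>x\<in>fiber E b. \<forall>y\<in>fiber E b. \<phi> (vadd E x y) = (\<lambda>i. \<phi> x i + \<phi> y i)) \<and>
    (\<forall>b\<in>U. \<forall>a. \<forall>x\<in>fiber E b. \<phi> (vscale E a x) = (\<lambda>i. a * \<phi> x i))"

definition vector_bundle :: "('b::topological_space, 'e::topological_space) vbundle \<Rightarrow> bool"
  where "vector_bundle E \<longleftrightarrow>
    continuous_on UNIV (proj E) \<and>
    (\<forall>b. vector_space_fiber E b) \<and>
    (\<forall>b. \<exists>U n \<phi>. b \<in> U \<and> trivialization E U n \<phi>)"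

definition equivariant_vector_bundle ::
  "('g::topological_group_add \<Rightarrow> 'b \<Rightarrow> 'b) \<Rightarrow>
    ('b::topological_space, 'e::topological_space) vbundle \<Rightarrow> ('g \<Rightarrow> 'e \<Rightarrow> 'e) \<Rightarrow> bool"
  where "equivariant_vector_bundle act E actE \<longleftrightarrow>
    vector_bundle E \<and>
    continuous_action actE \<and>
    (\<forall>g x. proj E (actE g x) = act g (proj E x)) \<and>
    (\<forall>g b. fiber_linear E E b (act g b) (actE g))"

definition continuous_section ::
  "('b::topological_space, 'e::topological_space) vbundle \<Rightarrow> ('b \<Rightarrow> 'e) \<Rightarrow> bool"
  where "continuous_section E f \<longleftrightarrow> continuous_on UNIV f \<and> (\<forall>b. proj E (f b) = b)"

section \<open>The bundle Hom(\<open>E \<times> B\<close>, \<open>B \<times> F\<close>) over \<open>B \<times> B\<close>\<close>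

text \<open>Homomorphisms are made extensional, so that the fiber over \<open>(c, b)\<close> is exactly the
  set of linear maps from the fiber of \<open>E\<close> over \<open>c\<close> to the fiber of \<open>F\<close> over \<open>b\<close>.\<close>

definition hom_fiber ::
  "('b, 'e) vbundle \<Rightarrow> ('b, 'f) vbundle \<Rightarrow> 'b \<Rightarrow> 'b \<Rightarrow> ('e \<Rightarrow> 'f) set"
  where "hom_fiber E F c b = {L \<in> extensional (fiber E c). fiber_linear E F c b L}"

definition hom_total ::
  "('b, 'e) vbundle \<Rightarrow> ('b, 'f) vbundle \<Rightarrow> (('b \<times> 'b) \<times> ('e \<Rightarrow> 'f)) set"
  where "hom_total E F = {((c, b), L). L \<in> hom_fiber E F c b}"

text \<open>The \<open>(i, j)\<close> matrix entry of \<open>L\<close> in fiber coordinates \<open>\<phi>\<close> of \<open>E\<close> and \<open>\<psi>\<close> of \<open>F\<close>.\<close>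

definition hom_entry ::
  "('b, 'e) vbundle \<Rightarrow> ('e \<Rightarrow> nat \<Rightarrow> real) \<Rightarrow> ('f \<Rightarrow> nat \<Rightarrow> real) \<Rightarrow> nat \<Rightarrow> nat \<Rightarrow>
    'b \<Rightarrow> ('e \<Rightarrow> 'f) \<Rightarrow> real"
  where "hom_entry E \<phi> \<psi> i j c L =
    \<psi> (L (inv_into (fiber E c) \<phi> (\<lambda>k. if k = j then 1 else 0))) i"

text \<open>The bundle topology: trivializations of \<open>E\<close> over \<open>U\<close> and of \<open>F\<close> over \<open>V\<close> identify the
  part over \<open>U \<times> V\<close> with \<open>(U \<times> V) \<times> \<real>\<^bsup>n \<times> m\<^esup>\<close> via matrix entries.\<close>

definition hom_topology ::
  "('b::topological_space, 'e::topological_space) vbundle \<Rightarrow>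
    ('b, 'f::topological_space) vbundle \<Rightarrow> (('b \<times> 'b) \<times> ('e \<Rightarrow> 'f)) topology"
  where "hom_topology E F = topology_generated_by
    ({{p \<in> hom_total E F. fst p \<in> W} | W. open W} \<union>
     {{((c, b), L) \<in> hom_total E F. c \<in> U \<and> b \<in> V \<and> hom_entry E \<phi> \<psi> i j c L \<in> W}
       | U m \<phi> V n \<psi> i j W. trivialization E U m \<phi> \<and> trivialization F V n \<psi> \<and>
           i < n \<and> j < m \<and> open W})"

section \<open>Integration in a fiber\<close>

text \<open>The integral of a function into the finite-dimensional vector space \<open>fiber F b\<close>,
  characterized componentwise, i.e. by all linear functionals on that fiber.\<close>

definition has_fiber_integral ::
  "('b, 'f) vbundle \<Rightarrow> 'b \<Rightarrow> 'a measure \<Rightarrow> ('a \<Rightarrow> 'f) \<Rightarrow> 'f \<Rightarrow> bool"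
  where "has_fiber_integral F b M u v \<longleftrightarrow>
    v \<in> fiber F b \<and> (\<forall>x\<in>space M. u x \<in> fiber F b) \<and>
    (\<forall>l. fiber_functional F b l \<longrightarrow> has_bochner_integral M (\<lambda>x. l (u x)) (l v))"

definition fiber_integral ::
  "('b, 'f) vbundle \<Rightarrow> 'b \<Rightarrow> 'a measure \<Rightarrow> ('a \<Rightarrow> 'f) \<Rightarrow> 'f"
  where "fiber_integral F b M u = (THE v. has_fiber_integral F b M u v)"

section \<open>Integral transforms, cross-correlation and filters\<close>

definition kernel_nonzero ::
  "('b, 'e) vbundle \<Rightarrow> ('b, 'f) vbundle \<Rightarrow> ('b \<Rightarrow> 'b \<Rightarrow> 'e \<Rightarrow> 'f) \<Rightarrow> 'b \<Rightarrow> 'b \<Rightarrow> bool"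
  where "kernel_nonzero E F \<kappa> c b \<longleftrightarrow> (\<exists>v\<in>fiber E c. \<kappa> c b v \<noteq> vzero F b)"

definition orbitwise_transform ::
  "('b, 'f) vbundle \<Rightarrow> ('b \<Rightarrow> 'b measure) \<Rightarrow> ('b \<Rightarrow> 'b \<Rightarrow> 'e \<Rightarrow> 'f) \<Rightarrow> ('b \<Rightarrow> 'e) \<Rightarrow> 'b \<Rightarrow> 'f"
  where "orbitwise_transform F mubar \<kappa> f b = fiber_integral F b (mubar b) (\<lambda>c. \<kappa> c b (f c))"

definition mackey_section ::
  "('g::group_add \<Rightarrow> 'b \<Rightarrow> 'b) \<Rightarrow> ('g \<Rightarrow> 'e \<Rightarrow> 'e) \<Rightarrow> ('b \<Rightarrow> 'e) \<Rightarrow> 'g \<Rightarrow> 'b \<Rightarrow> 'e"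
  where "mackey_section act actE f h b = actE (- h) (f (act h b))"

definition cross_correlation ::
  "('b, 'f) vbundle \<Rightarrow> ('b \<Rightarrow> 'g::group_add measure) \<Rightarrow> ('g \<Rightarrow> 'b \<Rightarrow> 'e \<Rightarrow> 'f) \<Rightarrow>
    ('g \<Rightarrow> 'b \<Rightarrow> 'e) \<Rightarrow> 'g \<Rightarrow> 'b \<Rightarrow> 'f"
  where "cross_correlation F mu \<omega> s h b =
    fiber_integral F b (mu b) (\<lambda>k. \<omega> k b (s (h + k) b))"

definition kernel_filter ::
  "('g::group_add \<Rightarrow> 'b \<Rightarrow> 'b) \<Rightarrow> ('g \<Rightarrow> 'e \<Rightarrow> 'e) \<Rightarrow> ('b, 'f) vbundle \<Rightarrow> ('g \<Rightarrow> 'b \<Rightarrow> real) \<Rightarrow>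
    ('b \<Rightarrow> 'b \<Rightarrow> 'e \<Rightarrow> 'f) \<Rightarrow> ('b \<times> 'b) set \<Rightarrow> ('b \<Rightarrow> 'b \<Rightarrow> 'g) \<Rightarrow> 'g \<Rightarrow> 'b \<Rightarrow> 'e \<Rightarrow> 'f"
  where "kernel_filter act actE F \<delta> \<kappa> R \<theta> h b v =
    (if (act h b, b) \<in> R
     then vscale F (\<delta> (- \<theta> (act h b) b + h) b) (\<kappa> (act h b) b (actE h v))
     else vzero F b)"

end

theory Submission
  imports Defs
begin

text \<open>
  At \<open>h = e\<close> the group elements acting on the section cancel, so the integrand of the
  cross-correlation at \<open>k\<close> is \<open>\<delta>(\<theta>(k.b,b)\<^sup>-\<^sup>1k, b) \<kappa>(k.b,b)(f(k.b))\<close>.  Composed with a linear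
  functional on the fiber of \<open>F\<close> over \<open>b\<close> it is a continuous function on \<open>G\<close>, supported in the
  compact product of the \<open>\<theta>\<close>-image of the support of \<open>\<kappa>(-,b)\<close> with the support of \<open>\<delta>(-,b)\<close>.
  Disintegrating along the orbit with representatives \<open>k = \<theta>(c,b)\<close>, the inner integrand becomes
  \<open>\<delta>(h,b) \<kappa>(c,b)(f(c))\<close>, and the normalization of \<open>\<delta>\<close> leaves \<open>T\<^sub>\<kappa>(f)(b)\<close>.  The fiber integrals
  are defined by a definite description, so both sides must also be shown integrable.
\<close>

section \<open>Coordinates of local trivializations and functionals on fibers\<close>

lemma trivialization_coord_continuous:
  assumes "trivialization E U n \<phi>"
  shows "continuous_on (proj E -` U) (\<lambda>x. \<phi> x i)"
proof -
  have "continuous_map (top_of_set (proj E -` U))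
      (prod_topology (top_of_set U) (Euclidean_space n)) (\<lambda>x. (proj E x, \<phi> x))"
    using assms by (simp add: trivialization_def homeomorphic_imp_continuous_map)
  then have "continuous_map (top_of_set (proj E -` U)) (powertop_real UNIV) \<phi>"
    by (auto simp: continuous_map_pairwise o_def Euclidean_space_def continuous_map_in_subtopology)
  then show ?thesis
    by (simp add: continuous_map_componentwise_UNIV)
qed

text \<open>The homeomorphism over \<open>U\<close> keeps the base point as its first component, so
  it restricts to a bijection of each single fiber with the model fiber.\<close>

lemma trivialization_bij_betw:
  assumes "trivialization E U n \<phi>" "c \<in> U"
  shows "bij_betw \<phi> (fiber E c) {v. \<forall>i\<ge>n. v i = 0}"
proof -
  have h: "homeomorphic_map (top_of_set (proj E -` U))
      (prod_topology (top_of_set U) (Euclidean_space n)) (\<lambda>x. (proj E x, \<phi> x))"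
    using assms by (simp add: trivialization_def)
  have inj: "inj_on (\<lambda>x. (proj E x, \<phi> x)) (proj E -` U)"
    using homeomorphic_imp_injective_map[OF h] by simp
  have surj: "(\<lambda>x. (proj E x, \<phi> x)) ` (proj E -` U) = U \<times> {v. \<forall>i\<ge>n. v i = 0}"
    using homeomorphic_imp_surjective_map[OF h] by (simp add: topspace_Euclidean_space)
  have "inj_on \<phi> (fiber E c)"
    using inj assms(2) by (auto simp: inj_on_def fiber_def)
  moreover have "\<phi> ` fiber E c = {v. \<forall>i\<ge>n. v i = 0}"
  proof (intro equalityI subsetI)
    fix v assume "v \<in> \<phi> ` fiber E c"
    then obtain x where "proj E x = c" "v = \<phi> x" by (auto simp: fiber_def)
    then have "(c, v) \<in> U \<times> {v. \<forall>i\<ge>n. v i = 0}"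
      using surj assms(2) by (metis (mono_tags, lifting) image_eqI vimage_eq)
    then show "v \<in> {v. \<forall>i\<ge>n. v i = 0}" by simp
  next
    fix v :: "nat \<Rightarrow> real" assume "v \<in> {v. \<forall>i\<ge>n. v i = 0}"
    then have "(c, v) \<in> (\<lambda>x. (proj E x, \<phi> x)) ` (proj E -` U)"
      using surj assms(2) by simp
    then show "v \<in> \<phi> ` fiber E c" by (auto simp: fiber_def)
  qed
  ultimately show ?thesis by (simp add: bij_betw_def)
qed

lemma fiber_functional_zero:
  assumes "vector_space_fiber E c" "fiber_functional E c l"
  shows "l (vzero E c) = 0"
proof -
  have "vzero E c \<in> fiber E c" "vadd E (vzero E c) (vzero E c) = vzero E c"
    using assms(1) by (simp_all add: vector_space_fiber_def)
  then have "l (vzero E c) = l (vzero E c) + l (vzero E c)"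
    using assms(2) unfolding fiber_functional_def by metis
  then show ?thesis by simp
qed

text \<open>The vectors picked by \<open>inv_into\<close> are the basis of the fiber that
  corresponds to the standard basis of the model fiber, and a linear functional is determined by its
  values there. The expansion is obtained by stripping off the last coordinate, one at a
  time.\<close>

lemma fiber_functional_coords:
  assumes triv: "trivialization E U n \<phi>" and c: "c \<in> U" and vs: "vector_space_fiber E c"
    and l: "fiber_functional E c l" and x: "x \<in> fiber E c"
  shows "l x = (\<Sum>j<n. \<phi> x j * l (inv_into (fiber E c) \<phi> (\<lambda>k. if k = j then 1 else 0)))"
proof -
  define e where "e j = inv_into (fiber E c) \<phi> (\<lambda>k. if k = j then 1 else 0)" for j
  note bij = trivialization_bij_betw[OF triv c]
  have e: "e j \<in> fiber E c" "\<phi> (e j) = (\<lambda>k. if k = j then 1 else 0)" if "j < n" for j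
  proof -
    have "(\<lambda>k. if k = j then 1 else 0) \<in> \<phi> ` fiber E c"
      using that bij by (auto simp: bij_betw_def)
    then show "e j \<in> fiber E c" "\<phi> (e j) = (\<lambda>k. if k = j then 1 else 0)"
      unfolding e_def by (simp_all add: inv_into_into f_inv_into_f)
  qed
  have add: "\<phi> (vadd E y z) = (\<lambda>i. \<phi> y i + \<phi> z i)" "vadd E y z \<in> fiber E c"
      "l (vadd E y z) = l y + l z" if "y \<in> fiber E c" "z \<in> fiber E c" for y z
    using that triv c vs l
    by (auto simp: trivialization_def vector_space_fiber_def fiber_functional_def)
  have scale: "\<phi> (vscale E a y) = (\<lambda>i. a * \<phi> y i)" "vscale E a y \<in> fiber E c"
      "l (vscale E a y) = a * l y" if "y \<in> fiber E c" for a y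
    using that triv c vs l
    by (auto simp: trivialization_def vector_space_fiber_def fiber_functional_def)
  have eqI: "y = z" if "y \<in> fiber E c" "z \<in> fiber E c" "\<phi> y = \<phi> z" for y z
    using that bij by (auto simp: bij_betw_def inj_on_def)
  \<comment> \<open>Induction on a bound \<open>k\<close> for the coordinates that may be nonzero;
    the case \<open>k = n\<close> covers the whole fiber.\<close>
  have "l y = (\<Sum>j<k. \<phi> y j * l (e j))"
    if "k \<le> n" "y \<in> fiber E c" "\<forall>i\<ge>k. \<phi> y i = 0" for k y
    using that
  proof (induction k arbitrary: y)
    case 0
    \<comment> \<open>A vector without nonzero coordinates equals its own multiple by 0, since
      \<open>\<phi>\<close> is injective on the fiber; homogeneity then makes \<open>l\<close>
      vanish on it.\<close>
    have "y = vscale E 0 y"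
      using 0 by (intro eqI) (auto simp: scale)
    then have "l y = 0 * l y" using scale(3)[OF 0(2), of 0] by simp
    then show ?case by simp
  next
    case (Suc k)
    define a where "a = \<phi> y k"
    \<comment> \<open>Subtracting \<open>a\<close> times the basis vector \<open>e k\<close> kills
      coordinate \<open>k\<close> and leaves the others unchanged, so the induction hypothesis
      applies to \<open>z\<close>.\<close>
    define z where "z = vadd E y (vscale E (- a) (e k))"
    have k: "k < n" using Suc by simp
    have z: "z \<in> fiber E c" "\<phi> z = (\<lambda>i. if i = k then 0 else \<phi> y i)"
      "l z = l y - a * l (e k)"
      using Suc.prems e[OF k] by (auto simp: z_def add scale a_def)
    have "l z = (\<Sum>j<k. \<phi> z j * l (e j))"
    proof (rule Suc.IH)
      show "\<forall>i\<ge>k. \<phi> z i = 0"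
        using Suc.prems(3) by (auto simp: z(2) not_less_eq_eq)
    qed (use k z in auto)
    also have "\<dots> = (\<Sum>j<k. \<phi> y j * l (e j))"
      by (simp add: z(2))
    finally show ?case using z(3) by (simp add: a_def)
  qed
  moreover have "\<forall>i\<ge>n. \<phi> x i = 0"
    using x bij by (auto simp: bij_betw_def)
  ultimately show ?thesis using x by (simp add: e_def)
qed

section \<open>Continuity of the kernel applied to a section\<close>

text \<open>Restricting \<open>\<kappa>\<close> to the slice with fixed \<open>b\<close> keeps it
  continuous into \<open>hom_topology\<close>, and conditions on matrix entries are among the
  generating open sets of that topology.\<close>

lemma hom_entry_continuous:
  assumes "trivialization E U m \<phi>" "trivialization F V n \<psi>" "i < n" "j < m" "b \<in> V"
    and \<kappa>: "continuous_map (top_of_set P) (hom_topology E F) (\<lambda>(c, b). ((c, b), \<kappa> c b))"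
    and C: "C \<subseteq> U" "C \<times> {b} \<subseteq> P"
    and hom: "\<And>c. c \<in> C \<Longrightarrow> \<kappa> c b \<in> hom_fiber E F c b"
  shows "continuous_on C (\<lambda>c. hom_entry E \<phi> \<psi> i j c (\<kappa> c b))"
proof -
  have "continuous_map (top_of_set C) (top_of_set P) (\<lambda>c. (c, b))"
    using C by (auto intro: continuous_on_Pair continuous_on_id continuous_on_const)
  from continuous_map_compose[OF this \<kappa>]
  have K: "continuous_map (top_of_set C) (hom_topology E F) (\<lambda>c. ((c, b), \<kappa> c b))"
    by (simp add: o_def)
  show ?thesis
    unfolding continuous_openin_preimage_eq
  proof (intro allI impI)
    fix W :: "real set" assume W: "open W"
    \<comment> \<open>\<open>Q\<close> is such a generator. Along the slice over \<open>C\<close>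
      its other conditions hold automatically, so its preimage is exactly the preimage of
      \<open>W\<close> under the matrix entry.\<close>
    define Q where "Q = {((c, b), L) \<in> hom_total E F.
      c \<in> U \<and> b \<in> V \<and> hom_entry E \<phi> \<psi> i j c L \<in> W}"
    have "openin (hom_topology E F) Q"
      unfolding hom_topology_def Q_def using assms W
      by (intro topology_generated_by_Basis UnI2 CollectI exI conjI) (rule refl | assumption)+
    from openin_continuous_map_preimage[OF K this]
    show "openin (top_of_set C) (C \<inter> (\<lambda>c. hom_entry E \<phi> \<psi> i j c (\<kappa> c b)) -` W)"
      by (rule back_subst[of "openin (top_of_set C)"])
        (use hom assms(5) C in \<open>auto simp: Q_def hom_total_def\<close>)
  qed
qed

text \<open>Continuity is local. Over trivializing neighbourhoods the scalar
  \<open>l (\<kappa> c b (f c))\<close> is a finite sum of products of coordinates of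
  \<open>f c\<close>, matrix entries of \<open>\<kappa> c b\<close> and constants \<open>a i\<close>
  coming from \<open>l\<close>.\<close>

lemma kernel_section_continuous:
  fixes E :: "('b::t2_space, 'e::topological_space) vbundle"
  assumes E: "vector_bundle E" and F: "vector_bundle F" and f: "continuous_section E f"
    and l: "fiber_functional F b l"
    and \<kappa>: "continuous_map (top_of_set P) (hom_topology E F) (\<lambda>(c, b). ((c, b), \<kappa> c b))"
    and C: "C \<times> {b} \<subseteq> P" and hom: "\<And>c. c \<in> C \<Longrightarrow> \<kappa> c b \<in> hom_fiber E F c b"
  shows "continuous_on C (\<lambda>c. l (\<kappa> c b (f c)))"
proof (unfold continuous_on_eq_continuous_within, rule ballI)
  fix c0 assume c0: "c0 \<in> C"
  obtain U m \<phi> where U: "c0 \<in> U" "trivialization E U m \<phi>"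
    using E unfolding vector_bundle_def by blast
  obtain V n \<psi> where V: "b \<in> V" "trivialization F V n \<psi>"
    using F unfolding vector_bundle_def by blast
  have "open U" using U(2) by (simp add: trivialization_def)
  define a where "a i = l (inv_into (fiber F b) \<psi> (\<lambda>k. if k = i then 1 else 0))" for i
  have expand: "l (\<kappa> c b (f c))
      = (\<Sum>j<m. \<phi> (f c) j * (\<Sum>i<n. hom_entry E \<phi> \<psi> i j c (\<kappa> c b) * a i))"
    if c: "c \<in> C \<inter> U" for c
  proof -
    have lin: "fiber_linear E F c b (\<kappa> c b)"
      using hom c by (simp add: hom_fiber_def)
    \<comment> \<open>Pulling \<open>l\<close> back along \<open>\<kappa> c b\<close> gives a
      functional on the fiber of \<open>E\<close>. The coordinate expansion is used twice: for this
      pullback on the fiber of \<open>E\<close>, then for \<open>l\<close> on the images of the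
      basis vectors.\<close>
    have "fiber_functional E c (\<lambda>x. l (\<kappa> c b x))"
      using lin l by (simp add: fiber_functional_def fiber_linear_def)
    moreover have "vector_space_fiber E c" "f c \<in> fiber E c"
      using E f by (simp_all add: vector_bundle_def continuous_section_def fiber_def)
    ultimately have 1: "l (\<kappa> c b (f c)) = (\<Sum>j<m. \<phi> (f c) j *
        l (\<kappa> c b (inv_into (fiber E c) \<phi> (\<lambda>k. if k = j then 1 else 0))))"
      using fiber_functional_coords[OF U(2)] c by blast
    have 2: "l (\<kappa> c b (inv_into (fiber E c) \<phi> (\<lambda>k. if k = j then 1 else 0)))
        = (\<Sum>i<n. hom_entry E \<phi> \<psi> i j c (\<kappa> c b) * a i)" if "j < m" for j
    proof -
      have "inv_into (fiber E c) \<phi> (\<lambda>k. if k = j then 1 else 0) \<in> fiber E c"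
        using trivialization_bij_betw[OF U(2), of c] c that
        by (intro inv_into_into) (auto simp: bij_betw_def)
      then have "\<kappa> c b (inv_into (fiber E c) \<phi> (\<lambda>k. if k = j then 1 else 0)) \<in> fiber F b"
        using lin by (simp add: fiber_linear_def)
      moreover have "vector_space_fiber F b"
        using F by (simp add: vector_bundle_def)
      ultimately show ?thesis
        unfolding a_def hom_entry_def using fiber_functional_coords[OF V(2,1) _ l] by blast
    qed
    show ?thesis unfolding 1 by (intro sum.cong refl) (simp add: 2)
  qed
  have "continuous_on (C \<inter> U) (\<lambda>c. \<phi> (f c) j)" for j
    using f by (intro continuous_on_compose2[OF trivialization_coord_continuous[OF U(2)]])
      (auto simp: continuous_section_def intro: continuous_on_subset)
  moreover have "continuous_on (C \<inter> U) (\<lambda>c. hom_entry E \<phi> \<psi> i j c (\<kappa> c b))"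
    if "i < n" "j < m" for i j
    using C hom by (intro hom_entry_continuous[OF U(2) V(2) that V(1) \<kappa>]) auto
  ultimately have "continuous_on (C \<inter> U)
      (\<lambda>c. \<Sum>j<m. \<phi> (f c) j * (\<Sum>i<n. hom_entry E \<phi> \<psi> i j c (\<kappa> c b) * a i))"
    by (intro continuous_intros) auto
  then have "continuous_on (C \<inter> U) (\<lambda>c. l (\<kappa> c b (f c)))"
    by (rule continuous_on_eq) (simp only: expand)
  moreover have "at c0 within C \<inter> U = at c0 within C"
    using U(1) \<open>open U\<close> by (intro at_within_nhd[of _ U]) auto
  ultimately show "continuous (at c0 within C) (\<lambda>c. l (\<kappa> c b (f c)))"
    using c0 U(1) by (metis IntI continuous_on_eq_continuous_within)
qed

section \<open>Integrability against locally finite Borel measures, and fiber integrals\<close>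

lemma locally_finite_borel_measure_on_sets:
  "locally_finite_borel_measure_on S M \<Longrightarrow> sets M = sets (restrict_space borel S)"
  by (simp add: locally_finite_borel_measure_on_def)

lemma locally_finite_borel_measure_on_space:
  assumes "locally_finite_borel_measure_on S M"
  shows "space M = S"
  using sets_eq_imp_space_eq[OF locally_finite_borel_measure_on_sets[OF assms]]
  by (simp add: space_restrict_space)

text \<open>Finitely many open sets whose traces on \<open>S\<close> have finite measure cover
  \<open>K\<close>, and the measure is subadditive. The cover is intersected with \<open>S\<close>
  because \<open>M\<close> measures only subsets of \<open>S\<close>.\<close>

lemma emeasure_compact_finite:
  assumes M: "locally_finite_borel_measure_on S M" and K: "compact K" "K \<in> sets M"
  shows "emeasure M K < \<infinity>"
proof -
  note sets = locally_finite_borel_measure_on_sets[OF M]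
  have "K \<subseteq> S"
    using K(2) sets.sets_into_space locally_finite_borel_measure_on_space[OF M] by blast
  define \<U> where "\<U> = {U. open U \<and> emeasure M (U \<inter> S) < \<infinity>}"
  have "K \<subseteq> \<Union>\<U>"
  proof
    fix x assume "x \<in> K"
    then have "x \<in> S" using \<open>K \<subseteq> S\<close> by blast
    then obtain U where "open U" "x \<in> U" "emeasure M (U \<inter> S) < \<infinity>"
      using M unfolding locally_finite_borel_measure_on_def by meson
    then show "x \<in> \<Union>\<U>" by (auto simp: \<U>_def)
  qed
  moreover have "open U" if "U \<in> \<U>" for U using that by (simp add: \<U>_def)
  ultimately obtain \<V> where \<V>: "\<V> \<subseteq> \<U>" "finite \<V>" "K \<subseteq> \<Union>\<V>"
    by (rule compactE[OF K(1)])
  have meas: "U \<inter> S \<in> sets M" if "U \<in> \<V>" for U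
  proof -
    have "U \<in> sets borel" using that \<V>(1) by (auto simp: \<U>_def)
    then show ?thesis unfolding sets sets_restrict_space by (metis Int_commute imageI)
  qed
  have "emeasure M K \<le> emeasure M (\<Union>U\<in>\<V>. U \<inter> S)"
    using \<V>(2,3) \<open>K \<subseteq> S\<close> meas
    by (intro emeasure_mono sets.finite_UN) blast+
  also have "\<dots> \<le> (\<Sum>U\<in>\<V>. emeasure M (U \<inter> S))"
    using \<V>(2) meas by (intro emeasure_subadditive_finite) auto
  also have "\<dots> < \<infinity>"
    using \<V>(1,2) by (auto simp: \<U>_def less_top)
  finally show ?thesis .
qed

text \<open>A continuous function is bounded on its compact support, which has finite measure, and
  it vanishes on the rest of \<open>S\<close>.\<close>

lemma integrable_compactly_supported:
  assumes M: "locally_finite_borel_measure_on S M"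
    and f: "continuous_on S f" "compactly_supported_on S f"
  shows "integrable M f"
proof -
  note sets = locally_finite_borel_measure_on_sets[OF M]
    and space = locally_finite_borel_measure_on_space[OF M]
  define K where "K = support_in S {x \<in> S. f x \<noteq> 0}"
  have K: "compact K" "K \<subseteq> S"
    using f(2) by (simp_all add: K_def compactly_supported_on_def support_in_def)
  \<comment> \<open>The relative support is the trace on \<open>S\<close> of a closed set, hence
    measurable for \<open>M\<close>.\<close>
  have KM: "K \<in> sets M"
    by (auto simp: sets sets_restrict_space K_def support_in_def)
  have "bounded (f ` K)"
    using K f(1) by (intro compact_imp_bounded compact_continuous_image) (auto intro: continuous_on_subset)
  then obtain B where B: "\<And>x. x \<in> K \<Longrightarrow> norm (f x) \<le> B"
    by (auto simp: bounded_iff)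
  have "f \<in> borel_measurable M"
    using borel_measurable_continuous_on_restrict[OF f(1)] sets
    by (simp cong: measurable_cong_sets)
  moreover have "f x = 0" if "x \<in> S" "x \<notin> K" for x
    using that closure_subset[of "{x \<in> S. f x \<noteq> 0}"] by (auto simp: K_def support_in_def)
  ultimately show ?thesis
    using KM emeasure_compact_finite[OF M K(1) KM] B space
    by (intro integrableI_bounded_set[of K _ _ B]) auto
qed

text \<open>The predicates under the two definite descriptions coincide, so the described vectors
  do. Integrability is assumed on both sides because \<open>has_bochner_integral\<close> includes
  it, while equal values of the integrals alone would not relate the predicates.\<close>

lemma fiber_integral_eqI:
  assumes "\<And>x. x \<in> space M \<Longrightarrow> u x \<in> fiber F b" "\<And>y. y \<in> space N \<Longrightarrow> w y \<in> fiber F b"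
    and int: "\<And>l. fiber_functional F b l \<Longrightarrow> integrable M (\<lambda>x. l (u x))"
      "\<And>l. fiber_functional F b l \<Longrightarrow> integrable N (\<lambda>y. l (w y))"
    and eq: "\<And>l. fiber_functional F b l \<Longrightarrow> (\<integral>x. l (u x) \<partial>M) = (\<integral>y. l (w y) \<partial>N)"
  shows "fiber_integral F b M u = fiber_integral F b N w"
proof -
  have "has_bochner_integral M (\<lambda>x. l (u x)) (l v) \<longleftrightarrow> has_bochner_integral N (\<lambda>y. l (w y)) (l v)"
    if "fiber_functional F b l" for l v
    using that int eq by (simp add: has_bochner_integral_iff)
  then have "has_fiber_integral F b M u = has_fiber_integral F b N w"
    using assms(1,2) by (auto simp: has_fiber_integral_def fun_eq_iff)
  then show ?thesis by (simp add: fiber_integral_def)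
qed

section \<open>The cross-correlation at the neutral element\<close>

theorem theorem4p7:
  fixes act :: "'g::{topological_group_add, t2_space} \<Rightarrow> 'b::t2_space \<Rightarrow> 'b"
    and E :: "('b, 'e::topological_space) vbundle" and actE :: "'g \<Rightarrow> 'e \<Rightarrow> 'e"
    and F :: "('b, 'f::topological_space) vbundle" and actF :: "'g \<Rightarrow> 'f \<Rightarrow> 'f"
    and mu :: "'b \<Rightarrow> 'g measure" and mubar :: "'b \<Rightarrow> 'b measure" and nu :: "'b \<Rightarrow> 'g measure"
    and \<delta> :: "'g \<Rightarrow> 'b \<Rightarrow> real"
    and \<kappa> :: "'b \<Rightarrow> 'b \<Rightarrow> 'e \<Rightarrow> 'f"
    and R :: "('b \<times> 'b) set" and \<theta> :: "'b \<Rightarrow> 'b \<Rightarrow> 'g"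
    and f :: "'b \<Rightarrow> 'e" and b :: 'b
  assumes act: "continuous_action act"
    and E: "equivariant_vector_bundle act E actE"
    and F: "equivariant_vector_bundle act F actF"
    (* the measures *)
    and mu: "\<And>b. locally_finite_borel_measure_on UNIV (mu b)"
    and mubar: "\<And>b. locally_finite_borel_measure_on (orbit act b) (mubar b)"
    and nu: "\<And>b. locally_finite_borel_measure_on (stabilizer act b) (nu b)"
    and nu_left_invariant:
      "\<And>b g. g \<in> stabilizer act b \<Longrightarrow> distr (nu b) (nu b) (\<lambda>h. g + h) = nu b"
    and mu_conj: "\<And>g b. mu (act g b) = distr (mu b) (mu (act g b)) (\<lambda>h. g + h - g)"
    and nu_conj: "\<And>g b. nu (act g b) = distr (nu b) (nu (act g b)) (\<lambda>h. g + h - g)"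
    and mubar_transl: "\<And>g b. mubar (act g b) = distr (mubar b) (mubar (act g b)) (act g)"
    and mu_continuous:
      "\<And>f'. continuous_on UNIV f' \<Longrightarrow> compactly_supported_on UNIV f' \<Longrightarrow>
        continuous_on UNIV (\<lambda>b. \<integral>h. f' h \<partial>mu b)"
    and disintegration:
      "\<And>b f' k. continuous_on UNIV f' \<Longrightarrow> compactly_supported_on UNIV f' \<Longrightarrow>
        (\<And>c. c \<in> orbit act b \<Longrightarrow> act (k c) b = c) \<Longrightarrow>
        (\<integral>h. f' h \<partial>mu b) = (\<integral>c. (\<integral>h. f' (k c + h) \<partial>nu b) \<partial>mubar b)"
    (* the function delta *)
    and \<delta>_continuous: "continuous_on {(h, b). h \<in> stabilizer act b} (\<lambda>(h, b). \<delta> h b)"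
    and \<delta>_nonneg: "\<And>h b. h \<in> stabilizer act b \<Longrightarrow> 0 \<le> \<delta> h b"
    and \<delta>_supp: "\<And>b. compactly_supported_on (stabilizer act b) (\<lambda>h. \<delta> h b)"
    and \<delta>_normalized: "\<And>b. (\<integral>h. \<delta> h b \<partial>nu b) = 1"
    and \<delta>_conj: "\<And>g h b. h \<in> stabilizer act b \<Longrightarrow> \<delta> (g + h - g) (act g b) = \<delta> h b"
    (* the kernel *)
    and \<kappa>_hom: "\<And>c b. c \<in> orbit act b \<Longrightarrow> \<kappa> c b \<in> hom_fiber E F c b"
    and \<kappa>_continuous:
      "continuous_map (top_of_set (orbit_pairs act)) (hom_topology E F)
        (\<lambda>(c, b). ((c, b), \<kappa> c b))"
    and \<kappa>_supp:
      "\<And>b. compact (support_in (orbit act b) {c \<in> orbit act b. kernel_nonzero E F \<kappa> c b})"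
    and \<kappa>_equivariant:
      "\<And>g c b v. c \<in> orbit act b \<Longrightarrow> v \<in> fiber E c \<Longrightarrow>
        actF g (\<kappa> c b v) = \<kappa> (act g c) (act g b) (actE g v)"
    (* the choice of R and theta *)
    and R_closed: "closedin (top_of_set (orbit_pairs act)) R"
    and R_supp:
      "support_in (orbit_pairs act) {(c, b) \<in> orbit_pairs act. kernel_nonzero E F \<kappa> c b} \<subseteq> R"
    and R_invariant: "\<And>g c b. (c, b) \<in> R \<Longrightarrow> (act g c, act g b) \<in> R"
    and \<theta>_continuous: "continuous_on R (\<lambda>(c, b). \<theta> c b)"
    and \<theta>_act: "\<And>c b. (c, b) \<in> R \<Longrightarrow> c = act (\<theta> c b) b"
    and \<theta>_equivariant:
      "\<And>g c b. (c, b) \<in> R \<Longrightarrow> g + \<theta> c b = \<theta> (act g c) (act g b) + g"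
    (* the section *)
    and f: "continuous_section E f"
  shows "cross_correlation F mu (kernel_filter act actE F \<delta> \<kappa> R \<theta>) (mackey_section act actE f) 0 b
    = orbitwise_transform F mubar \<kappa> f b"
proof -
  have act_zero: "act 0 x = x" and act_add: "act (g + h) x = act g (act h x)"
    and act_cont: "continuous_on S (\<lambda>k. act k x)" for g h x S
  proof -
    have "continuous_on S ((\<lambda>(g, x). act g x) \<circ> (\<lambda>k. (k, x)))"
      using act by (intro continuous_on_compose continuous_intros)
        (auto simp: continuous_action_def intro: continuous_on_subset)
    then show "continuous_on S (\<lambda>k. act k x)" by (simp add: o_def)
  qed (use act in \<open>simp_all add: continuous_action_def\<close>)
  have Eb: "vector_bundle E" "continuous_action actE" and Fb: "vector_bundle F"
    using E F by (simp_all add: equivariant_vector_bundle_def)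
  have orbit_pair: "(act k b, b) \<in> orbit_pairs act" "act k b \<in> orbit act b" for k
    by (auto simp: orbit_pairs_def orbit_def)
  note space_nu = locally_finite_borel_measure_on_space[OF nu[of b]]
    and space_mubar = locally_finite_borel_measure_on_space[OF mubar[of b]]

  \<comment> \<open>Both \<open>k\<close> and \<open>\<theta> (act k b) b\<close> carry
    \<open>b\<close> to \<open>act k b\<close>, so their quotient fixes \<open>b\<close>. Hence the
    filter evaluates \<open>\<delta>\<close> inside its domain.\<close>
  have \<theta>_stab: "- \<theta> (act k b) b + k \<in> stabilizer act b" if "(act k b, b) \<in> R" for k
  proof -
    have "act (- \<theta> (act k b) b + k) b = act (- \<theta> (act k b) b) (act (\<theta> (act k b) b) b)"
      by (simp only: act_add flip: \<theta>_act[OF that])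
    also have "\<dots> = act (- \<theta> (act k b) b + \<theta> (act k b) b) b"
      by (simp only: act_add)
    finally show ?thesis by (simp add: act_zero stabilizer_def)
  qed
  have \<kappa>_fiber: "\<kappa> c b (f c) \<in> fiber F b" if "c \<in> orbit act b" for c
    using \<kappa>_hom[OF that] f
    by (simp add: hom_fiber_def fiber_linear_def continuous_section_def fiber_def)

  define K where "K = support_in (orbit act b) {c \<in> orbit act b. kernel_nonzero E F \<kappa> c b}"
  \<comment> \<open>Continuity of the embedding of the slice puts the support of the slice of
    \<open>\<kappa>\<close> into the slice of the support of \<open>\<kappa>\<close>, where
    \<open>R_supp\<close> applies. Thus \<open>\<theta>\<close> is available on all of
    \<open>K\<close>.\<close>
  have "K \<times> {b} \<subseteq> R"
  proof -
    define N where "N = {(c, b) \<in> orbit_pairs act. kernel_nonzero E F \<kappa> c b}"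
    have "(\<lambda>c. (c, b)) ` closure {c \<in> orbit act b. kernel_nonzero E F \<kappa> c b} \<subseteq> closure N"
    proof (rule image_closure_subset)
      show "(\<lambda>c. (c, b)) ` {c \<in> orbit act b. kernel_nonzero E F \<kappa> c b} \<subseteq> closure N"
        using closure_subset[of N] by (auto simp: N_def orbit_pairs_def)
    qed (auto intro: continuous_on_Pair continuous_on_id continuous_on_const)
    then have "K \<times> {b} \<subseteq> support_in (orbit_pairs act) N"
      by (auto simp: K_def support_in_def orbit_pairs_def)
    then show ?thesis using R_supp by (auto simp: N_def)
  qed

  \<comment> \<open>The unsimplified \<open>0 + k\<close> matches the integrand of
    \<open>cross_correlation\<close> at the neutral element when the definitions are unfolded at the
    end.\<close>
  define u where "u k = kernel_filter act actE F \<delta> \<kappa> R \<theta> k b (mackey_section act actE f (0 + k) b)"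
    for k
  have u: "u k = (if (act k b, b) \<in> R
      then vscale F (\<delta> (- \<theta> (act k b) b + k) b) (\<kappa> (act k b) b (f (act k b))) else vzero F b)" for k
  proof -
    have "actE k (actE (- k) x) = x" for x
      using Eb(2) by (metis add.right_inverse continuous_action_def)
    then show ?thesis by (simp add: u_def kernel_filter_def mackey_section_def)
  qed
  have vs: "vector_space_fiber F b" using Fb by (simp add: vector_bundle_def)
  have "fiber_integral F b (mu b) u = fiber_integral F b (mubar b) (\<lambda>c. \<kappa> c b (f c))"
  proof (rule fiber_integral_eqI)
    show "u k \<in> fiber F b" for k
      using vs \<kappa>_fiber orbit_pair by (simp add: u vector_space_fiber_def)
  next
    show "\<kappa> c b (f c) \<in> fiber F b" if "c \<in> space (mubar b)" for c
      using that \<kappa>_fiber space_mubar by simp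
  next
    fix l assume l: "fiber_functional F b l"
    define p where "p c = l (\<kappa> c b (f c))" for c
    \<comment> \<open>\<open>p\<close> and \<open>q\<close> are the \<open>l\<close>-components of
      the integrands on the orbit and on the group. The default 0 in \<open>q\<close> agrees with
      the zero vector in the filter, which \<open>l\<close> sends to 0.\<close>
    define q where "q k = (if (act k b, b) \<in> R
      then \<delta> (- \<theta> (act k b) b + k) b * p (act k b) else 0)" for k
    note l_zero = fiber_functional_zero[OF vs l]
    have lu: "l (u k) = q k" for k
      using l l_zero \<kappa>_fiber orbit_pair by (simp add: u q_def p_def fiber_functional_def)

    have p_cont: "continuous_on (orbit act b) p"
      unfolding p_def using Eb(1) Fb f l \<kappa>_continuous \<kappa>_hom
      by (intro kernel_section_continuous) (auto simp: orbit_pairs_def)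
    have p_nonzero: "kernel_nonzero E F \<kappa> c b" if "p c \<noteq> 0" for c
      using that f l_zero
      by (auto simp: p_def kernel_nonzero_def continuous_section_def fiber_def)
    have p_supp: "c \<in> K" if "c \<in> orbit act b" "p c \<noteq> 0" for c
      using that p_nonzero closure_subset[of "{c \<in> orbit act b. kernel_nonzero E F \<kappa> c b}"]
      by (auto simp: K_def support_in_def)
    have "compactly_supported_on (orbit act b) p"
    proof -
      define N where "N = {c \<in> orbit act b. p c \<noteq> 0}"
      have "N \<subseteq> {c \<in> orbit act b. kernel_nonzero E F \<kappa> c b}"
        using p_nonzero by (auto simp: N_def)
      from closure_mono[OF this] have "support_in (orbit act b) N = K \<inter> closure N"
        by (auto simp: K_def support_in_def)
      then show ?thesis
        using \<kappa>_supp[of b] compact_Int_closed[of K "closure N"]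
        by (simp add: compactly_supported_on_def K_def N_def)
    qed
    from integrable_compactly_supported[OF mubar p_cont this]
    show "integrable (mubar b) (\<lambda>c. l (\<kappa> c b (f c)))"
      by (simp add: p_def[abs_def])

    text \<open>\<open>R\<close> need not be a neighbourhood of the support of \<open>\<kappa>\<close>; continuity of \<open>q\<close> is obtained by
      gluing along the closed cover of \<open>G\<close> by the preimages of \<open>R\<close> and of the zero set of \<open>p\<close>.\<close>
    have q_cont: "continuous_on UNIV q"
    proof -
      define A where "A = {k. (act k b, b) \<in> R}"
      define Z where "Z = {k. p (act k b) = 0}"
      obtain T where T: "closed T" "R = orbit_pairs act \<inter> T"
        using R_closed by (auto simp: closedin_closed)
      \<comment> \<open>The pairs \<open>(act k b, b)\<close> always lie in
        \<open>orbit_pairs act\<close>, so \<open>R\<close> and \<open>T\<close> have the same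
        preimage, and relative closedness of \<open>R\<close> becomes closedness of \<open>A\<close>
        in the group.\<close>
      have "A = (\<lambda>k. (act k b, b)) -` T"
        using T(2) orbit_pair by (auto simp: A_def)
      moreover have "closed ((\<lambda>k. (act k b, b)) -` T)"
        by (intro closed_vimage T(1) continuous_intros act_cont)
      ultimately have A: "closed A" by simp
      have p_act: "continuous_on UNIV (\<lambda>k. p (act k b))"
        using orbit_pair by (intro continuous_on_compose2[OF p_cont act_cont]) auto
      have Z: "closed Z"
        unfolding Z_def using p_act by (intro closed_Collect_eq continuous_intros)
      have cover: "A \<union> Z = UNIV"
      proof -
        have "k \<in> A" if "p (act k b) \<noteq> 0" for k
          using p_supp[OF _ that] orbit_pair \<open>K \<times> {b} \<subseteq> R\<close> by (auto simp: A_def)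
        then show ?thesis by (auto simp: Z_def)
      qed
      have "continuous_on A (\<lambda>k. \<theta> (act k b) b)"
        using continuous_on_compose2[OF \<theta>_continuous
            continuous_on_Pair[OF act_cont[of A b] continuous_on_const[of A b]]]
        by (auto simp: A_def)
      then have "continuous_on A (\<lambda>k. (- \<theta> (act k b) b + k, b))"
        by (intro continuous_intros)
      from continuous_on_compose2[OF \<delta>_continuous this]
      have "continuous_on A (\<lambda>k. \<delta> (- \<theta> (act k b) b + k) b)"
        using \<theta>_stab by (auto simp: A_def)
      then have "continuous_on A (\<lambda>k. \<delta> (- \<theta> (act k b) b + k) b * p (act k b))"
        by (intro continuous_intros continuous_on_subset[OF p_act]) auto
      \<comment> \<open>On \<open>Z\<close> the factor \<open>p (act k b)\<close> is 0, so both
        branches agree on the overlap.\<close>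
      then have "continuous_on (A \<union> Z) (\<lambda>k. if k \<in> A
          then \<delta> (- \<theta> (act k b) b + k) b * p (act k b) else 0)"
        using A Z by (intro continuous_on_If) (auto simp: Z_def)
      moreover have "q = (\<lambda>k. if k \<in> A then \<delta> (- \<theta> (act k b) b + k) b * p (act k b) else 0)"
        by (simp add: fun_eq_iff q_def A_def)
      ultimately show ?thesis by (simp only: cover)
    qed
    have q_supp: "compactly_supported_on UNIV q"
    proof -
      define D where "D = support_in (stabilizer act b) {h \<in> stabilizer act b. \<delta> h b \<noteq> 0}"
      define C where "C = (\<lambda>(c, h). \<theta> c b + h) ` (K \<times> D)"
      have "continuous_on K (\<lambda>c. \<theta> c b)"
        using continuous_on_compose2[OF \<theta>_continuous
            continuous_on_Pair[OF continuous_on_id[of K] continuous_on_const[of K b]]]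
          \<open>K \<times> {b} \<subseteq> R\<close>
        by auto
      from continuous_on_compose2[OF this continuous_on_fst[OF continuous_on_id], of "K \<times> D"]
      have "continuous_on (K \<times> D) (\<lambda>x. \<theta> (fst x) b)"
        by fastforce
      from continuous_on_add[OF this continuous_on_snd[OF continuous_on_id]]
      have "continuous_on (K \<times> D) (\<lambda>x. \<theta> (fst x) b + snd x)" .
      moreover have "compact (K \<times> D)"
        using \<kappa>_supp[of b] \<delta>_supp[of b]
        by (intro compact_Times) (simp_all add: K_def D_def compactly_supported_on_def)
      ultimately have C: "compact C"
        unfolding C_def by (intro compact_continuous_image) (simp_all add: case_prod_unfold)
      \<comment> \<open>Split \<open>k\<close> as \<open>\<theta> (act k b) b\<close> times
        \<open>- \<theta> (act k b) b + k\<close>. If \<open>q k\<close> is nonzero, then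
        \<open>act k b\<close> lies in \<open>K\<close> and the second factor in
        \<open>D\<close>.\<close>
      have "{k. q k \<noteq> 0} \<subseteq> C"
      proof
        fix k assume "k \<in> {k. q k \<noteq> 0}"
        then have k: "(act k b, b) \<in> R" "\<delta> (- \<theta> (act k b) b + k) b \<noteq> 0" "p (act k b) \<noteq> 0"
          by (auto simp: q_def split: if_splits)
        have "- \<theta> (act k b) b + k \<in> D"
          using k(2) \<theta>_stab[OF k(1)] closure_subset[of "{h \<in> stabilizer act b. \<delta> h b \<noteq> 0}"]
          by (auto simp: D_def support_in_def)
        moreover have "act k b \<in> K" using p_supp k(3) orbit_pair by simp
        ultimately show "k \<in> C"
          unfolding C_def by (intro image_eqI[of _ _ "(act k b, - \<theta> (act k b) b + k)"])
            (simp_all flip: add.assoc)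
      qed
      \<comment> \<open>The compact set \<open>C\<close> is closed because the group is
        Hausdorff.\<close>
      then have "closure {k. q k \<noteq> 0} \<subseteq> C"
        by (intro closure_minimal compact_imp_closed C)
      then have "closure {k. q k \<noteq> 0} = C \<inter> closure {k. q k \<noteq> 0}" by blast
      then have "compact (closure {k. q k \<noteq> 0})"
        using compact_Int_closed[OF C] by (metis closed_closure)
      then show ?thesis by (simp add: compactly_supported_on_def support_in_def)
    qed
    from integrable_compactly_supported[OF mu q_cont q_supp]
    show "integrable (mu b) (\<lambda>k. l (u k))" by (simp add: lu)

    \<comment> \<open>Disintegration needs representatives on the whole orbit, whereas
      \<open>\<theta>\<close> is controlled only on \<open>R\<close>. Elsewhere any representative
      serves, since \<open>q\<close> is 0 there.\<close>
    define s where "s c = (if (c, b) \<in> R then \<theta> c b else SOME g. act g b = c)" for c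
    have s: "act (s c) b = c" if "c \<in> orbit act b" for c
    proof (cases "(c, b) \<in> R")
      case True
      then show ?thesis by (simp add: s_def flip: \<theta>_act)
    next
      case False
      then show ?thesis
        using that by (auto simp: s_def orbit_def intro: someI)
    qed
    \<comment> \<open>As \<open>h\<close> fixes \<open>b\<close>, the point reached is
      \<open>c\<close> itself. Over \<open>R\<close> the representative cancels against
      \<open>\<theta> c b\<close> and leaves \<open>\<delta> h b\<close>; off \<open>R\<close> both
      sides are 0, because there \<open>c\<close> is outside \<open>K\<close> and so
      \<open>p c = 0\<close>.\<close>
    have q_s: "q (s c + h) = \<delta> h b * p c" if c: "c \<in> orbit act b" and h: "h \<in> stabilizer act b" for c h
    proof -
      have "act (s c + h) b = c"
        using h s[OF c] by (simp add: act_add stabilizer_def)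
      then show ?thesis
        using p_supp[OF c] \<open>K \<times> {b} \<subseteq> R\<close> by (auto simp: q_def s_def simp flip: add.assoc)
    qed
    have "(\<integral>k. l (u k) \<partial>mu b) = (\<integral>c. (\<integral>h. q (s c + h) \<partial>nu b) \<partial>mubar b)"
      unfolding lu by (rule disintegration[OF q_cont q_supp s])
    also have "\<dots> = (\<integral>c. (\<integral>h. \<delta> h b * p c \<partial>nu b) \<partial>mubar b)"
      by (intro Bochner_Integration.integral_cong refl) (simp add: q_s space_nu space_mubar)
    also have "\<dots> = (\<integral>c. p c \<partial>mubar b)"
      by (simp add: \<delta>_normalized)
    finally show "(\<integral>k. l (u k) \<partial>mu b) = (\<integral>c. l (\<kappa> c b (f c)) \<partial>mubar b)"
      by (simp add: p_def)
  qed
  then show ?thesis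
    by (simp only: cross_correlation_def orbitwise_transform_def u_def[abs_def])
qed

end
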